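(* Let $p=q=1/2$ and let $X_{n,s}$ be the number of turns required to end the single-player pile game with boundary with set of choices $R=\{1,-1\}$ and target $n$, starting with $s$ chips, $0\le s\le n$. Then $$E[X_{n,s}]=n(n+1)-s(s+1).$$
   Context: Single-player pile game with boundary, $R=\{1,-1\}$: the player starts with $s$ chips, $0\le s\le n$. In each turn, independently, with probability $p$ one chip is added, and with probability $q=1-p$ one chip is removed, except that if the player has $0$ chips he stays at $0$ instead. The game ends when the player first has $n$ chips (at turn $0$ if $s=n$). *)

theory Defs
  imports "HOL-Probability.Probability"
begin

text \<open>
  The choices of the player: \<open>\<xi> t\<close> is the choice from \<open>{1, -1}\<close> made in turn \<open>t + 1\<close>.
  The two probabilities add up to one, so other values occur with probability zero.
\<close>

locale pile_choices = prob_space M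
  for M :: "'a measure" and p :: real and \<xi> :: "nat \<Rightarrow> 'a \<Rightarrow> int" +
  assumes indep_choices: "indep_vars (\<lambda>_. count_space UNIV) \<xi> UNIV"
    and prob_add: "\<P>(\<omega> in M. \<xi> t \<omega> = 1) = p"
    and prob_remove: "\<P>(\<omega> in M. \<xi> t \<omega> = -1) = 1 - p"

definition pile_step :: "nat \<Rightarrow> int \<Rightarrow> nat" where
  "pile_step c r = (if int c + r < 0 then 0 else nat (int c + r))"

text \<open>
  The number of chips after \<open>t\<close> turns. The recursion does not stop at the target; this is
  harmless since only the first time at which the target is reached is used below.
\<close>

primrec pile_chips :: "nat \<Rightarrow> (nat \<Rightarrow> int) \<Rightarrow> nat \<Rightarrow> nat" where
  "pile_chips s r 0 = s"
| "pile_chips s r (Suc t) = pile_step (pile_chips s r t) (r t)"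

text \<open>The value is \<open>\<infinity>\<close> if the game never ends.\<close>

definition pile_turns :: "nat \<Rightarrow> nat \<Rightarrow> (nat \<Rightarrow> int) \<Rightarrow> enat" where
  "pile_turns n s r =
     (if \<exists>t. pile_chips s r t = n then enat (LEAST t. pile_chips s r t = n) else \<infinity>)"

end

theory Submission
  imports Defs
begin

text \<open>
  With \<open>h k = k (k + 1)\<close>, one turn adds \<open>1 + \<xi> (2 k + 1)\<close> to \<open>h k\<close>, also at the boundary
  \<open>k = 0\<close>. As the choices are centred and independent of the past, \<open>h n - h X\<^sub>t\<close>,
  restricted to the event that the game is still running after turn \<open>t\<close>, loses in the mean
  exactly the probability of that event. Summing over the turns gives \<open>h n - h s\<close>, since the
  boundedness of \<open>h n - h X\<^sub>t\<close> forces the remainder to vanish.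
\<close>

section \<open>The event that the game is still running\<close>

definition running :: "nat \<Rightarrow> nat \<Rightarrow> (nat \<Rightarrow> int) \<Rightarrow> nat \<Rightarrow> bool" where
  "running n s r t \<longleftrightarrow> (\<forall>i\<le>t. pile_chips s r i \<noteq> n)"

lemma running_Suc: "running n s r (Suc t) \<longleftrightarrow> running n s r t \<and> pile_chips s r (Suc t) \<noteq> n"
  by (auto simp: running_def le_Suc_eq)

text \<open>\<open>running\<close> inspects all turns up to \<open>t\<close> because the recursion
  goes on past the target. With this equivalence its probabilities are the tail probabilities of the
  number of turns, also when the game never ends.\<close>

lemma less_pile_turns_iff: "enat t < pile_turns n s r \<longleftrightarrow> running n s r t"
proof (cases "\<exists>i. pile_chips s r i = n")
  case True
  then obtain i where i: "pile_chips s r i = n" by blast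
  have "t < (LEAST i. pile_chips s r i = n) \<longleftrightarrow> (\<forall>i\<le>t. pile_chips s r i \<noteq> n)"
  proof (intro iffI allI impI notI)
    fix j assume "t < (LEAST i. pile_chips s r i = n)" "j \<le> t" "pile_chips s r j = n"
    then show False using not_less_Least[of j "\<lambda>i. pile_chips s r i = n"] by simp
  next
    assume "\<forall>i\<le>t. pile_chips s r i \<noteq> n"
    then show "t < (LEAST i. pile_chips s r i = n)"
      using LeastI[of "\<lambda>i. pile_chips s r i = n", OF i] not_less by blast
  qed
  then show ?thesis using True by (simp add: pile_turns_def running_def)
qed (auto simp: pile_turns_def running_def)

section \<open>Dependence on past choices and measurability\<close>

lemma pile_chips_cong:
  "(\<And>i. i < t \<Longrightarrow> r i = r' i) \<Longrightarrow> pile_chips s r t = pile_chips s r' t"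
  by (induction t) auto

text \<open>The strict bound \<open>i < t\<close> matters: whether the game is still running after
  \<open>t\<close> turns does not involve \<open>r t\<close>, which decides the next turn. This
  gives the independence in \<open>drift_choice\<close>.\<close>

lemma running_cong:
  assumes "\<And>i. i < t \<Longrightarrow> r i = r' i"
  shows "running n s r t = running n s r' t"
proof -
  have "pile_chips s r i = pile_chips s r' i" if "i \<le> t" for i
    using assms that by (intro pile_chips_cong) auto
  then show ?thesis by (auto simp: running_def)
qed

text \<open>Measurability is assumed only for \<open>i < t\<close>, so that the lemma applies on
  \<open>M\<close> and also on the product over \<open>{..<t}\<close>, which carries only those
  coordinates.\<close>

lemma measurable_pile_chips:
  assumes "\<And>i. i < t \<Longrightarrow> (\<lambda>x. f x i) \<in> N \<rightarrow>\<^sub>M count_space UNIV"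
  shows "(\<lambda>x. pile_chips s (f x) t) \<in> N \<rightarrow>\<^sub>M count_space UNIV"
  using assms
proof (induction t)
  case (Suc t)
  have [measurable]: "(\<lambda>x. pile_chips s (f x) t) \<in> N \<rightarrow>\<^sub>M count_space UNIV"
    "(\<lambda>x. f x t) \<in> N \<rightarrow>\<^sub>M count_space UNIV"
    using Suc by auto
  show ?case by simp
qed simp

lemma measurable_running:
  assumes "\<And>i. i < t \<Longrightarrow> (\<lambda>x. f x i) \<in> N \<rightarrow>\<^sub>M count_space UNIV"
  shows "Measurable.pred N (\<lambda>x. running n s (f x) t)"
  using assms
proof (induction t)
  case (Suc t)
  have [measurable]: "(\<lambda>x. pile_chips s (f x) (Suc t)) \<in> N \<rightarrow>\<^sub>M count_space UNIV"
    by (intro measurable_pile_chips Suc.prems)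
  have [measurable]: "Measurable.pred N (\<lambda>x. running n s (f x) t)"
    using Suc by simp
  show ?case unfolding running_Suc by measurable
qed (simp add: running_def)

lemma measurable_pile_turns:
  assumes [measurable]: "\<And>i. (\<lambda>x. f x i) \<in> N \<rightarrow>\<^sub>M count_space UNIV"
  shows "(\<lambda>x. pile_turns n s (f x)) \<in> N \<rightarrow>\<^sub>M count_space UNIV"
proof -
  have [measurable]: "(\<lambda>x. pile_chips s (f x) t) \<in> N \<rightarrow>\<^sub>M count_space UNIV" for t
    by (rule measurable_pile_chips) measurable
  show ?thesis unfolding pile_turns_def by measurable
qed

text \<open>A turn adds at most one chip, so the pile cannot jump over \<open>n\<close>.\<close>

lemma running_imp_less:
  assumes "s \<le> n" "\<And>i. r i \<in> {1, -1}" "running n s r t"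
  shows "pile_chips s r t < n"
  using assms(3)
proof (induction t)
  case 0
  then show ?case using assms(1) by (simp add: running_def)
next
  case (Suc t)
  then have "pile_chips s r t < n" "pile_step (pile_chips s r t) (r t) \<noteq> n"
    by (auto simp: running_Suc)
  then show ?case using assms(2)[of t] by (auto simp: pile_step_def)
qed

section \<open>The potential and its change in one turn\<close>

definition potential :: "nat \<Rightarrow> real" where
  "potential k = real k * (real k + 1)"

lemma potential_mono: "k \<le> n \<Longrightarrow> potential k \<le> potential n"
  unfolding potential_def by (intro mult_mono) auto

lemma potential_nonneg [simp]: "0 \<le> potential k"
  by (simp add: potential_def)

text \<open>Off the boundary, expand \<open>(k + r) * (k + r + 1)\<close> and use
  \<open>r * r = 1\<close>. At the boundary the same formula holds because
  \<open>x * (x + 1)\<close> takes the same value at -1 and at 0, so staying at 0 counts like a move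
  to -1.\<close>

lemma potential_pile_step:
  assumes "r \<in> {1, -1}"
  shows "potential (pile_step k r) = potential k + 1 + (2 * real k + 1) * real_of_int r"
  using assms by (cases k) (auto simp: potential_def pile_step_def nat_add_distrib algebra_simps)

definition remaining :: "nat \<Rightarrow> nat \<Rightarrow> (nat \<Rightarrow> int) \<Rightarrow> nat \<Rightarrow> real" where
  "remaining n s r t = of_bool (running n s r t) * (potential n - potential (pile_chips s r t))"

text \<open>If the turn ends the game, the new potential equals \<open>potential n\<close>, so the
  indicator for \<open>Suc t\<close> may be replaced by that for \<open>t\<close>; the rest is
  \<open>potential_pile_step\<close>.\<close>

lemma remaining_Suc:
  assumes "r t \<in> {1, -1}"
  shows "remaining n s r (Suc t) = remaining n s r t - of_bool (running n s r t)
    - of_bool (running n s r t) * (2 * real (pile_chips s r t) + 1) * real_of_int (r t)"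
  using potential_pile_step[OF assms, of "pile_chips s r t"]
  by (auto simp: remaining_def running_Suc)

section \<open>The fair choices and the mean loss per turn\<close>

context
  fixes M :: "'a measure" and \<xi> :: "nat \<Rightarrow> 'a \<Rightarrow> int" and n s :: nat
  assumes fair: "pile_choices M (1/2) \<xi>" and le: "s \<le> n"
begin

interpretation pile_choices M "1/2" \<xi>
  by (rule fair)

lemma choices_measurable [measurable]: "\<xi> t \<in> M \<rightarrow>\<^sub>M count_space UNIV"
  using indep_choices by (auto simp: indep_vars_def)

lemma pile_chips_measurable [measurable]:
  "(\<lambda>\<omega>. pile_chips s (\<lambda>t. \<xi> t \<omega>) t) \<in> M \<rightarrow>\<^sub>M count_space UNIV"
  by (rule measurable_pile_chips) measurable

lemma running_measurable [measurable]: "Measurable.pred M (\<lambda>\<omega>. running n s (\<lambda>t. \<xi> t \<omega>) t)"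
  by (rule measurable_running) measurable

lemma AE_choices: "AE \<omega> in M. \<forall>t. \<xi> t \<omega> \<in> {1, -1}"
proof -
  have "AE \<omega> in M. \<xi> t \<omega> = 1 \<or> \<xi> t \<omega> = -1" for t
  proof -
    have "prob {\<omega> \<in> space M. \<xi> t \<omega> = 1 \<or> \<xi> t \<omega> = -1}
        = prob ({\<omega> \<in> space M. \<xi> t \<omega> = 1} \<union> {\<omega> \<in> space M. \<xi> t \<omega> = -1})"
      by (rule arg_cong[where f = prob]) auto
    also have "\<dots> = 1"
      by (subst finite_measure_Union) (auto simp: prob_add prob_remove)
    finally show ?thesis by (subst (asm) prob_Collect_eq_1) auto
  qed
  then show ?thesis by (simp add: AE_all_countable)
qed

lemma integrable_choice: "integrable M (\<lambda>\<omega>. real_of_int (\<xi> t \<omega>))"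
proof (rule integrable_const_bound[where B = 1])
  show "AE \<omega> in M. norm (real_of_int (\<xi> t \<omega>)) \<le> 1"
    using AE_choices
  proof eventually_elim
    case (elim \<omega>)
    show ?case using spec[OF elim, of t] by auto
  qed
qed simp

lemma expectation_choice: "expectation (\<lambda>\<omega>. real_of_int (\<xi> t \<omega>)) = 0"
proof -
  let ?A = "\<lambda>r. {\<omega> \<in> space M. \<xi> t \<omega> = r}"
  \<comment> \<open>Values other than 1 and -1 form a null event, so the mean reduces to two
    probabilities.\<close>
  have "expectation (\<lambda>\<omega>. real_of_int (\<xi> t \<omega>))
      = expectation (\<lambda>\<omega>. indicator (?A 1) \<omega> - indicator (?A (-1)) \<omega>)"
  proof (rule integral_cong_AE)
    show "AE \<omega> in M. real_of_int (\<xi> t \<omega>) = indicator (?A 1) \<omega> - indicator (?A (-1)) \<omega>"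
      using AE_choices AE_space
    proof eventually_elim
      case (elim \<omega>)
      show ?case using spec[OF elim(1), of t] elim(2) by (auto simp: indicator_def)
    qed
  qed measurable
  also have "\<dots> = prob (?A 1) - prob (?A (-1))"
    by (subst Bochner_Integration.integral_diff)
      (auto intro!: integrable_real_indicator simp: less_top[symmetric])
  finally show ?thesis by (simp add: prob_add prob_remove)
qed

text \<open>The coefficient of \<open>r t\<close> in \<open>remaining_Suc\<close>, up to sign. It is
  determined before the choice \<open>r t\<close> is made, so its product with a fair choice is a
  martingale difference.\<close>

definition drift :: "(nat \<Rightarrow> int) \<Rightarrow> nat \<Rightarrow> real" where
  "drift r t = of_bool (running n s r t) * (2 * real (pile_chips s r t) + 1)"

lemma integrable_drift: "integrable M (\<lambda>\<omega>. drift (\<lambda>t. \<xi> t \<omega>) t)"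
proof (rule integrable_const_bound[where B = "2 * real n + 1"])
  show "AE \<omega> in M. norm (drift (\<lambda>t. \<xi> t \<omega>) t) \<le> 2 * real n + 1"
    using AE_choices
  proof eventually_elim
    case (elim \<omega>)
    then show ?case
      using running_imp_less[OF le, of "\<lambda>t. \<xi> t \<omega>" t] by (auto simp: drift_def)
  qed
qed (simp add: drift_def)

text \<open>\<open>drift\<close> at \<open>t\<close> is a function of the choices before
  \<open>t\<close>, hence independent of \<open>\<xi> t\<close>. So the mean of the product factors,
  and the factor from \<open>expectation_choice\<close> is 0.\<close>

lemma drift_choice:
  "integrable M (\<lambda>\<omega>. drift (\<lambda>t. \<xi> t \<omega>) t * real_of_int (\<xi> t \<omega>))" (is ?int)
  "expectation (\<lambda>\<omega>. drift (\<lambda>t. \<xi> t \<omega>) t * real_of_int (\<xi> t \<omega>)) = 0" (is ?exp)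
proof -
  let ?P = "\<lambda>I. \<Pi>\<^sub>M i\<in>I. count_space (UNIV :: int set)"
  \<comment> \<open>Restriction makes the coordinates from \<open>t\<close> on
    \<open>undefined\<close>; \<open>drift\<close> never reads them.\<close>
  have past: "drift (restrict (\<lambda>i. \<xi> i \<omega>) {..<t}) t = drift (\<lambda>i. \<xi> i \<omega>) t" for \<omega>
    unfolding drift_def
    by (intro arg_cong2[where f = times] arg_cong[where f = of_bool] running_cong
        arg_cong[where f = "\<lambda>k. 2 * real k + 1"] pile_chips_cong) auto
  have indep: "indep_var (?P {..<t}) (\<lambda>\<omega>. restrict (\<lambda>i. \<xi> i \<omega>) {..<t})
      (?P {t}) (\<lambda>\<omega>. restrict (\<lambda>i. \<xi> i \<omega>) {t})"
    by (rule indep_var_restrict[OF indep_choices]) auto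
  have comp: "(\<lambda>r. r i) \<in> ?P {..<t} \<rightarrow>\<^sub>M count_space UNIV" if "i < t" for i
    using that by (intro measurable_component_singleton) auto
  have [measurable]: "(\<lambda>r. pile_chips s r t) \<in> ?P {..<t} \<rightarrow>\<^sub>M count_space UNIV"
    "Measurable.pred (?P {..<t}) (\<lambda>r. running n s r t)"
    using comp by (auto intro: measurable_pile_chips measurable_running)
  have "indep_var borel ((\<lambda>r. drift r t) \<circ> (\<lambda>\<omega>. restrict (\<lambda>i. \<xi> i \<omega>) {..<t}))
      borel ((\<lambda>r. real_of_int (r t)) \<circ> (\<lambda>\<omega>. restrict (\<lambda>i. \<xi> i \<omega>) {t}))"
    by (rule indep_var_compose[OF indep]) (simp_all add: drift_def)
  then have *: "indep_var borel (\<lambda>\<omega>. drift (\<lambda>t. \<xi> t \<omega>) t) borel (\<lambda>\<omega>. real_of_int (\<xi> t \<omega>))"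
    by (simp add: comp_def past)
  show ?int
    by (rule indep_var_integrable[OF * integrable_drift integrable_choice])
  show ?exp
    by (subst indep_var_lebesgue_integral[OF * integrable_drift integrable_choice])
      (simp add: expectation_choice)
qed

text \<open>The upper bound keeps the indicator: after integration it yields
  \<open>potential n * survival t\<close>, which tends to 0, where a constant bound would
  not.\<close>

lemma AE_remaining:
  "AE \<omega> in M. 0 \<le> remaining n s (\<lambda>t. \<xi> t \<omega>) t \<and>
    remaining n s (\<lambda>t. \<xi> t \<omega>) t \<le> potential n * of_bool (running n s (\<lambda>t. \<xi> t \<omega>) t)"
  using AE_choices
proof eventually_elim
  case (elim \<omega>)
  then show ?case
    using running_imp_less[OF le, of "\<lambda>t. \<xi> t \<omega>" t]
      potential_mono[of "pile_chips s (\<lambda>t. \<xi> t \<omega>) t" n]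
    by (auto simp: remaining_def)
qed

lemma integrable_running: "integrable M (\<lambda>\<omega>. of_bool (running n s (\<lambda>t. \<xi> t \<omega>) t) :: real)"
  by (rule integrable_const_bound[where B = 1]) auto

lemma integrable_remaining: "integrable M (\<lambda>\<omega>. remaining n s (\<lambda>t. \<xi> t \<omega>) t)"
proof (rule integrable_const_bound[where B = "potential n"])
  show "AE \<omega> in M. norm (remaining n s (\<lambda>t. \<xi> t \<omega>) t) \<le> potential n"
    using AE_remaining[of t]
    by eventually_elim (auto simp: of_bool_def split: if_splits)
qed (simp add: remaining_def)

text \<open>The tail probability P(X > t) of the number X of turns, written as an integral so that
  linearity applies directly.\<close>

definition survival :: "nat \<Rightarrow> real" where
  "survival t = expectation (\<lambda>\<omega>. of_bool (running n s (\<lambda>t. \<xi> t \<omega>) t))"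

lemma survival_eq: "survival t = prob {\<omega> \<in> space M. running n s (\<lambda>t. \<xi> t \<omega>) t}"
proof -
  have "survival t = expectation (indicator {\<omega> \<in> space M. running n s (\<lambda>t. \<xi> t \<omega>) t})"
    unfolding survival_def by (intro Bochner_Integration.integral_cong) auto
  then show ?thesis by simp
qed

lemma expectation_remaining:
  "0 \<le> expectation (\<lambda>\<omega>. remaining n s (\<lambda>t. \<xi> t \<omega>) t)"
  "expectation (\<lambda>\<omega>. remaining n s (\<lambda>t. \<xi> t \<omega>) t) \<le> potential n * survival t"
proof -
  show "0 \<le> expectation (\<lambda>\<omega>. remaining n s (\<lambda>t. \<xi> t \<omega>) t)"
    using AE_remaining[of t] by (intro integral_nonneg_AE) auto
  have "expectation (\<lambda>\<omega>. remaining n s (\<lambda>t. \<xi> t \<omega>) t)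
      \<le> expectation (\<lambda>\<omega>. potential n * of_bool (running n s (\<lambda>t. \<xi> t \<omega>) t))"
    using AE_remaining[of t] by (intro integral_mono_AE integrable_remaining
        integrable_mult_right integrable_running) auto
  then show "expectation (\<lambda>\<omega>. remaining n s (\<lambda>t. \<xi> t \<omega>) t) \<le> potential n * survival t"
    by (simp add: survival_def)
qed

lemma expectation_remaining_Suc:
  "expectation (\<lambda>\<omega>. remaining n s (\<lambda>t. \<xi> t \<omega>) (Suc t))
    = expectation (\<lambda>\<omega>. remaining n s (\<lambda>t. \<xi> t \<omega>) t) - survival t"
proof -
  have "expectation (\<lambda>\<omega>. remaining n s (\<lambda>t. \<xi> t \<omega>) (Suc t))
      = expectation (\<lambda>\<omega>. remaining n s (\<lambda>t. \<xi> t \<omega>) t - of_bool (running n s (\<lambda>t. \<xi> t \<omega>) t)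
          - drift (\<lambda>t. \<xi> t \<omega>) t * real_of_int (\<xi> t \<omega>))"
  proof (rule integral_cong_AE)
    show "AE \<omega> in M. remaining n s (\<lambda>t. \<xi> t \<omega>) (Suc t)
      = remaining n s (\<lambda>t. \<xi> t \<omega>) t - of_bool (running n s (\<lambda>t. \<xi> t \<omega>) t)
          - drift (\<lambda>t. \<xi> t \<omega>) t * real_of_int (\<xi> t \<omega>)"
      using AE_choices
      by eventually_elim (subst remaining_Suc, simp_all add: drift_def)
  qed (simp_all add: remaining_def drift_def del: pile_chips.simps)
  also have "\<dots> = expectation (\<lambda>\<omega>. remaining n s (\<lambda>t. \<xi> t \<omega>) t) - survival t"
    using integrable_remaining integrable_running drift_choice by (simp add: survival_def)
  finally show ?thesis .
qed

section \<open>Summation over the turns\<close>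

lemma sum_survival:
  "(\<Sum>i<t. survival i)
    = potential n - potential s - expectation (\<lambda>\<omega>. remaining n s (\<lambda>t. \<xi> t \<omega>) t)"
proof (induction t)
  case 0
  \<comment> \<open>If \<open>s = n\<close>, the game is over at turn 0; the indicator is then 0,
    but so is the potential difference.\<close>
  have "remaining n s r 0 = potential n - potential s" for r
    by (auto simp: remaining_def running_def)
  then show ?case by (simp add: prob_space)
qed (simp add: expectation_remaining_Suc)

text \<open>The remainder is nonnegative, so the partial sums are bounded and the terms tend to 0.
  By \<open>expectation_remaining\<close> this squeezes the remainder itself to 0. That the game
  ends almost surely comes out on the way.\<close>

lemma survival_sums: "survival sums (potential n - potential s)"
proof -
  have "summable survival"
  proof (rule summableI_nonneg_bounded)
    show "(\<Sum>i<t. survival i) \<le> potential n - potential s" for t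
      using expectation_remaining(1)[of t] by (simp add: sum_survival)
  qed (simp add: survival_eq)
  then have "survival \<longlonglongrightarrow> 0" by (rule summable_LIMSEQ_zero)
  then have "(\<lambda>t. potential n * survival t) \<longlonglongrightarrow> 0"
    by (rule tendsto_mult_right_zero)
  then have "(\<lambda>t. expectation (\<lambda>\<omega>. remaining n s (\<lambda>t. \<xi> t \<omega>) t)) \<longlonglongrightarrow> 0"
    by (rule tendsto_sandwich[OF _ _ tendsto_const, rotated 2])
      (intro always_eventually allI expectation_remaining)+
  from tendsto_diff[OF tendsto_const this] show ?thesis
    by (simp add: sums_def sum_survival)
qed

text \<open>The tail sum formula, E[X] as the sum of P(X > t) over t \<ge> 0, holds for values in
  \<open>enat\<close> including \<infinity>, so finiteness of the mean is a result and not
  presupposed.\<close>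

lemma nn_integral_pile_turns:
  "(\<integral>\<^sup>+ \<omega>. ennreal_of_enat (pile_turns n s (\<lambda>t. \<xi> t \<omega>)) \<partial>M)
    = ennreal (potential n - potential s)"
proof -
  have [measurable]: "(\<lambda>\<omega>. pile_turns n s (\<lambda>t. \<xi> t \<omega>)) \<in> M \<rightarrow>\<^sub>M count_space UNIV"
    by (rule measurable_pile_turns) measurable
  have "(\<integral>\<^sup>+ \<omega>. ennreal_of_enat (pile_turns n s (\<lambda>t. \<xi> t \<omega>)) \<partial>M) = (\<Sum>t. ennreal (survival t))"
    by (subst nn_integral_enat_function)
      (simp_all add: less_pile_turns_iff survival_eq emeasure_eq_measure)
  also have "\<dots> = ennreal (potential n - potential s)"
    by (rule suminf_ennreal_eq[OF _ survival_sums]) (simp add: survival_eq)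
  finally show ?thesis .
qed

end

theorem proposition4:
  fixes M :: "'a measure" and \<xi> :: "nat \<Rightarrow> 'a \<Rightarrow> int" and n s :: nat
  assumes "pile_choices M (1/2) \<xi>"
    and "s \<le> n"
  shows "(\<integral>\<^sup>+ \<omega>. ennreal_of_enat (pile_turns n s (\<lambda>t. \<xi> t \<omega>)) \<partial>M)
       = ennreal (real n * (real n + 1) - real s * (real s + 1))"
  using nn_integral_pile_turns[OF assms] by (simp add: potential_def)

end
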